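(* Let $\mathcal{A}$ be an associative algebra over a field $\mathbb{F}$ and let $R:\mathcal{A}\to\mathcal{A}$ be a linear map. Suppose that $R(R(x))=R(x)$ and $R(x)\cdot R(y)=R(x\cdot y)$ for all $x,y\in\mathcal{A}$. Then $$[x,y]=R(x)\cdot y-R(y)\cdot R(x)\quad\text{for all }x,y\in\mathcal{A}$$ defines a (left) Leibniz algebra structure on $\mathcal{A}$.
   Context: Associative algebras are not assumed to be unital or commutative. A (left) Leibniz algebra is a vector space $\mathcal{L}$ with a bilinear map $[\,,]:\mathcal{L}\times\mathcal{L}\to\mathcal{L}$ satisfying the left Leibniz identity $[x,[y,z]]=[[x,y],z]+[y,[x,z]]$ for all $x,y,z\in\mathcal{L}$. *)

theory Defs
  imports Complex_Main
begin

text \<open>The underlying vector space is the whole type \<open>'a\<close>. The product is only required to be bilinear: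
  neither associativity, commutativity nor a unit is assumed here.\<close>

locale bilinear_algebra = vector_space scale
  for scale :: "'f::field \<Rightarrow> 'a::ab_group_add \<Rightarrow> 'a" +
  fixes mul :: "'a \<Rightarrow> 'a \<Rightarrow> 'a"
  assumes linear_mul_right: "Vector_Spaces.linear scale scale (\<lambda>y. mul x y)"
    and linear_mul_left: "Vector_Spaces.linear scale scale (\<lambda>x. mul x y)"

locale associative_algebra = bilinear_algebra scale mul
  for scale :: "'f::field \<Rightarrow> 'a::ab_group_add \<Rightarrow> 'a"
    and mul :: "'a \<Rightarrow> 'a \<Rightarrow> 'a" +
  assumes mul_assoc: "mul (mul x y) z = mul x (mul y z)"

locale left_leibniz_algebra = bilinear_algebra scale bracket
  for scale :: "'f::field \<Rightarrow> 'a::ab_group_add \<Rightarrow> 'a"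
    and bracket :: "'a \<Rightarrow> 'a \<Rightarrow> 'a" +
  assumes left_leibniz:
    "bracket x (bracket y z) = bracket (bracket x y) z + bracket y (bracket x z)"

end

theory Submission
  imports Defs
begin

text \<open>
  The map \<^term>\<open>R\<close> is an idempotent algebra endomorphism, so it sends the bracket
  \<open>[x,y] = R x \<cdot> y - R y \<cdot> R x\<close> to the commutator of \<open>R x\<close> and \<open>R y\<close>. Writing \<open>X\<close>, \<open>Y\<close>, \<open>Z\<close>
  for the images of \<open>x\<close>, \<open>y\<close>, \<open>z\<close> and using that every bracket sees its left argument only
  through \<^term>\<open>R\<close>, one gets
  \<open>[x,[y,z]] = XYz - XZY - YZX + ZYX\<close>. On the other side,
  \<open>[[x,y],z] = (XY - YX)z - Z(XY - YX)\<close> and \<open>[y,[x,z]] = YXz - YZX - XZY + ZXY\<close>; the terms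
  \<open>YXz\<close> and \<open>ZXY\<close> cancel in their sum, which leaves the same four words.
\<close>

theorem lemma3p0p4:
  fixes scale :: "'f::field \<Rightarrow> 'a::ab_group_add \<Rightarrow> 'a"
    and mul :: "'a \<Rightarrow> 'a \<Rightarrow> 'a"
    and R :: "'a \<Rightarrow> 'a"
  assumes "associative_algebra scale mul"
    and "Vector_Spaces.linear scale scale R"
    and "\<And>x. R (R x) = R x"
    and "\<And>x y. mul (R x) (R y) = R (mul x y)"
  shows "left_leibniz_algebra scale (\<lambda>x y. mul (R x) y - mul (R y) (R x))"
proof -
  interpret A: associative_algebra scale mul by (fact assms(1))
  interpret R: Vector_Spaces.linear scale scale R by (fact assms(2))
  interpret left: Vector_Spaces.linear scale scale "\<lambda>x. mul x y" for y
    by (rule A.linear_mul_left)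
  interpret right: Vector_Spaces.linear scale scale "\<lambda>y. mul x y" for x
    by (rule A.linear_mul_right)
  note expand = left.add right.add left.diff right.diff left.scale right.scale
    R.add R.diff R.scale A.scale_right_diff_distrib
  have R_mul: "R (mul x y) = mul (R x) (R y)" for x y
    by (simp add: assms(4))
  show ?thesis
  proof
    fix x y z y' :: 'a and c :: 'f
    let ?b = "\<lambda>x y. mul (R x) y - mul (R y) (R x)"
    show "?b x (y + y') = ?b x y + ?b x y'" "?b (x + y') y = ?b x y + ?b y' y"
      by (simp_all add: expand)
    show "?b x (scale c y) = scale c (?b x y)" "?b (scale c x) y = scale c (?b x y)"
      by (simp_all add: expand)
    show "?b x (?b y z) = ?b (?b x y) z + ?b y (?b x z)"
      by (simp add: expand R_mul assms(3) A.mul_assoc)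
  qed
qed

end
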